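(* Let $\mathbf{q}=(q_1,\ldots,q_d)\in\mathbb{N}^d$ satisfy $\gcd\{q_1,\ldots,q_d\}=1$, and let $\boldsymbol{\alpha}\in\mathbb{R}^d$, $\mathbf{u}\in\{-1,1\}^d$. For $\mathbf{x}\in\mathbb{R}^d$ let $U(\mathbf{x})$ be the set of all $t\in[0,2\pi)$ satisfying $\mathfrak{l}^{(\mathbf{q})}_{\boldsymbol{\alpha},\mathbf{u}}(t)=\mathbf{x}$. (a) If $\mathfrak{l}^{(\mathbf{q})}_{\boldsymbol{\alpha},\mathbf{u}}$ is non-degenerate, then $\#U(\mathbf{x})>1$ for only finitely many $\mathbf{x}$. Furthermore, for each $\mathbf{x}$ we have $\#U(\mathbf{x})\leq 2^{d-1}$. (b) If $\mathfrak{l}^{(\mathbf{q})}_{\boldsymbol{\alpha},\mathbf{u}}$ is degenerate, then, up to precisely two exceptions, $\#U(\mathbf{x})\geq 2$ for $\mathbf{x}\in\mathfrak{l}^{(\mathbf{q})}_{\boldsymbol{\alpha},\mathbf{u}}([0,2\pi))$. There are only finitely many $\mathbf{x}$ with $\#U(\mathbf{x})>2$, and in this case $\#U(\mathbf{x})$ is even. Furthermore, for every $\mathbf{x}$ we have $\#U(\mathbf{x})\leq 2^{d}$.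
   Context: $\mathbb{N}=\{1,2,\ldots\}$, $d\in\mathbb{N}$. For $\mathbf{q}\in\mathbb{N}^d$, $\boldsymbol{\alpha}\in\mathbb{R}^d$ and $\mathbf{u}\in\{-1,1\}^d$, the Lissajous curve $\mathfrak{l}^{(\mathbf{q})}_{\boldsymbol{\alpha},\mathbf{u}}:\mathbb{R}\to[-1,1]^d$ is defined by $$\mathfrak{l}^{(\mathbf{q})}_{\boldsymbol{\alpha},\mathbf{u}}(t)=\bigl(u_1\cos(q_1t-\alpha_1),\ldots,u_d\cos(q_dt-\alpha_d)\bigr).$$ The curve is called degenerate if there exist $t'\in\mathbb{R}$ and $\mathbf{u}'\in\{-1,1\}^d$ such that $\mathfrak{l}^{(\mathbf{q})}_{\boldsymbol{\alpha},\mathbf{u}}(t-t')=\mathfrak{l}^{(\mathbf{q})}_{\mathbf{0},\mathbf{u}'}(t)$ for all $t\in\mathbb{R}$ (where $\mathbf{0}=(0,\ldots,0)$), and non-degenerate otherwise. $\#X$ denotes the number of elements of $X$. *)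

theory Defs
  imports "HOL-Analysis.Analysis"
begin

text \<open>The dimension \<open>d\<close> is the cardinality of the finite index type \<open>'d\<close>, so \<open>d \<ge> 1\<close> is automatic.\<close>

definition sign_vector :: "real ^ 'd \<Rightarrow> bool" where
  "sign_vector u \<longleftrightarrow> (\<forall>i. u $ i \<in> {-1, 1})"

definition lissajous ::
    "nat ^ 'd::finite \<Rightarrow> real ^ 'd \<Rightarrow> real ^ 'd \<Rightarrow> real \<Rightarrow> real ^ 'd" where
  "lissajous q \<alpha> u t = (\<chi> i. u $ i * cos (real (q $ i) * t - \<alpha> $ i))"

definition degenerate ::
    "nat ^ 'd::finite \<Rightarrow> real ^ 'd \<Rightarrow> real ^ 'd \<Rightarrow> bool" where
  "degenerate q \<alpha> u \<longleftrightarrow>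
     (\<exists>t' u'. sign_vector u' \<and> (\<forall>t. lissajous q \<alpha> u (t - t') = lissajous q 0 u' t))"

definition param_set ::
    "nat ^ 'd::finite \<Rightarrow> real ^ 'd \<Rightarrow> real ^ 'd \<Rightarrow> real ^ 'd \<Rightarrow> real set" where
  "param_set q \<alpha> u x = {t \<in> {0..<2 * pi}. lissajous q \<alpha> u t = x}"

end

theory Submission
  imports Defs
begin

text \<open>
  Write \<open>\<phi>\<^sub>i t = q\<^sub>i t - \<alpha>\<^sub>i\<close>. Two parameters \<open>s, t\<close> give the same point iff
  for each \<open>i\<close> one of \<open>\<phi>\<^sub>i s - \<phi>\<^sub>i t\<close>, \<open>\<phi>\<^sub>i s + \<phi>\<^sub>i t\<close> lies in \<open>2\<pi>\<int>\<close>.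
  If the first alternative holds for all \<open>i\<close>, then \<open>s - t \<in> 2\<pi>\<int>\<close> because the
  frequencies have gcd 1; if the second one does, the curve is symmetric about \<open>(s + t) / 2\<close>,
  which is exactly degeneracy. If both alternatives occur, \<open>s - t\<close> and \<open>s + t\<close> are restricted
  to finite sets. The signs of the \<open>sin (\<phi>\<^sub>i t)\<close> determine \<open>t\<close> within \<open>U(x)\<close>, and opposite
  sign patterns force a symmetry, which gives the bounds \<open>2\<^sup>d\<close> and \<open>2\<^sup>d\<^sup>-\<^sup>1\<close>. In the degenerate
  case the symmetry acts on the parameters as an involution with exactly two fixed points,
  and these two are simple points of the curve.
\<close>

section \<open>Angles modulo the period\<close>

text \<open>Membership of \<open>x\<close> in \<open>2\<pi>\<int>\<close> is expressed throughout as \<open>cos x = 1\<close>.\<close>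

lemma cos_eq_1_diff:
  fixes x y :: real
  assumes "cos x = cos y" "sin x = sin y"
  shows "cos (x - y) = 1"
  using assms sin_cos_squared_add[of y] by (simp add: cos_diff power2_eq_square)

lemma cos_eq_1_add:
  fixes x y :: real
  assumes "cos x = cos y" "sin x = - sin y"
  shows "cos (x + y) = 1"
  using assms sin_cos_squared_add[of y] by (simp add: cos_add power2_eq_square)

lemma cos_eq_1_minus:
  fixes x y :: real
  assumes "cos x = 1" "cos y = 1"
  shows "cos (x - y) = 1"
  using assms by (simp add: cos_diff cos_one_sin_zero)

lemma cos_reflect:
  fixes e x :: real
  assumes "cos e = 1"
  shows "cos (e - x) = cos x"
  using assms by (simp add: cos_diff cos_one_sin_zero)

lemma cos_double_eq_1_iff: "cos (2 * x) = 1 \<longleftrightarrow> sin x = 0" for x :: real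
  by (simp add: cos_double_sin)

lemma sin_eq_or_eq_minus:
  fixes x y :: real
  assumes "cos x = cos y"
  shows "sin x = sin y \<or> sin x = - sin y"
  using assms by (simp add: sin_squared_eq flip: power2_eq_iff)

lemma cos_eq_1_small:
  fixes x :: real
  assumes "cos x = 1" "\<bar>x\<bar> < 2 * pi"
  shows "x = 0"
proof -
  obtain n :: int where n: "x = of_int n * 2 * pi"
    using assms(1) cos_one_2pi_int by blast
  have "\<bar>real_of_int n\<bar> * (2 * pi) < 1 * (2 * pi)"
    using assms(2) by (simp add: n abs_mult)
  then have "\<bar>real_of_int n\<bar> < 1"
    by (simp only: mult_less_cancel_right_pos pi_gt_zero mult_pos_pos zero_less_numeral)
  then show ?thesis
    by (simp add: n)
qed

text \<open>The bounds are those of \<open>s + t - 2 * c\<close> for parameters \<open>s\<close>,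
  \<open>t\<close> in [0, 2 pi) and a centre of symmetry \<open>c\<close> in [0, pi).\<close>

lemma cos_eq_1_cases_4pi:
  fixes x :: real
  assumes "cos x = 1" "- (2 * pi) < x" "x < 4 * pi"
  shows "x = 0 \<or> x = 2 * pi"
proof (cases "x < 2 * pi")
  case True
  then show ?thesis using assms cos_eq_1_small[of x] by auto
next
  case False
  have "cos (x - 2 * pi) = 1"
    using assms(1) by (rule cos_eq_1_minus) simp
  then show ?thesis
    using False assms cos_eq_1_small[of "x - 2 * pi"] by auto
qed

text \<open>Put y = x / (2 pi). All n y with n in \<open>Q\<close> are integers, so y is rational,
  and its denominator in lowest terms divides every element of \<open>Q\<close>, hence divides
  1.\<close>

lemma cos_eq_1_Gcd:
  fixes x :: real and Q :: "nat set"
  assumes "\<And>n. n \<in> Q \<Longrightarrow> cos (real n * x) = 1" and "Gcd Q = 1"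
  shows "cos x = 1"
proof -
  define y where "y = x / (2 * pi)"
  have x: "x = y * 2 * pi"
    by (simp add: y_def)
  have int: "real n * y \<in> \<int>" if n: "n \<in> Q" for n
  proof -
    obtain k :: int where "real n * x = of_int k * 2 * pi"
      using assms(1)[OF n] cos_one_2pi_int by blast
    then have "real n * y = of_int k"
      by (simp add: y_def)
    then show ?thesis by simp
  qed
  have "\<exists>n\<in>Q. n \<noteq> 0"
  proof (rule ccontr)
    assume "\<not> ?thesis"
    then have "Gcd Q = 0" by (simp add: subset_iff)
    with assms(2) show False by simp
  qed
  then obtain n where n: "n \<in> Q" "n \<noteq> 0" by blast
  have "y = (real n * y) / real n"
    using n by simp
  moreover have "real n * y \<in> \<rat>"
    using int[OF n(1)] Ints_subset_Rats by blast
  ultimately have "y \<in> \<rat>"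
    by (metis Rats_divide Rats_of_nat)
  then obtain a b :: int where ab: "b > 0" "coprime a b" "y = of_int a / of_int b"
    by (rule Rats_cases')
  have "nat b dvd m" if m: "m \<in> Q" for m
  proof -
    obtain k :: int where "real m * y = of_int k"
      using int[OF m] by (auto elim: Ints_cases)
    then have "of_int (int m * a) = (of_int (k * b) :: real)"
      using ab by (simp add: field_simps)
    then have "int m * a = k * b"
      by (simp only: of_int_eq_iff)
    then have "b dvd int m * a" by simp
    then have "b dvd int m"
      using ab(2) by (simp add: coprime_dvd_mult_left_iff coprime_commute)
    then show ?thesis
      using ab(1) by (simp add: nat_dvd_iff)
  qed
  then have "nat b dvd Gcd Q"
    by (rule Gcd_greatest)
  then have "b = 1"
    using assms(2) ab(1) by simp
  then show ?thesis
    using ab(3) by (subst cos_one_2pi_int) (auto simp: x)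
qed

lemma finite_cos_eq_1:
  fixes a b c k :: real
  assumes "k \<noteq> 0"
  shows "finite {x. a \<le> x \<and> x \<le> b \<and> cos (k * x - c) = 1}"
proof -
  \<comment> \<open>On [a, b] one has |x| <= |a| + |b|, so \<open>M\<close> bounds |k x - c| and
    thereby the integer \<open>n\<close> below.\<close>
  define M where "M = \<bar>k\<bar> * (\<bar>a\<bar> + \<bar>b\<bar>) + \<bar>c\<bar>"
  have "{x. a \<le> x \<and> x \<le> b \<and> cos (k * x - c) = 1}
      \<subseteq> (\<lambda>n::int. (of_int n * 2 * pi + c) / k) ` {- \<lceil>M\<rceil>..\<lceil>M\<rceil>}"
  proof
    fix x assume "x \<in> {x. a \<le> x \<and> x \<le> b \<and> cos (k * x - c) = 1}"
    then have x: "a \<le> x" "x \<le> b" and "cos (k * x - c) = 1"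
      by auto
    then obtain n :: int where n: "k * x - c = of_int n * 2 * pi"
      using cos_one_2pi_int by blast
    have "\<bar>real_of_int n\<bar> * 1 \<le> \<bar>real_of_int n\<bar> * (2 * pi)"
      using pi_ge_two by (intro mult_left_mono) auto
    also have "\<dots> = \<bar>k * x - c\<bar>"
      by (simp add: n abs_mult)
    also have "\<dots> \<le> \<bar>k\<bar> * \<bar>x\<bar> + \<bar>c\<bar>"
      by (metis abs_mult abs_triangle_ineq4)
    also have "\<dots> \<le> M"
      unfolding M_def using x by (intro add_right_mono mult_left_mono) auto
    finally have "\<bar>n\<bar> \<le> \<lceil>M\<rceil>"
      by (simp add: le_ceiling_iff)
    then have "n \<in> {- \<lceil>M\<rceil>..\<lceil>M\<rceil>}" by auto
    moreover have "x = (of_int n * 2 * pi + c) / k"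
      using n assms by (simp add: field_simps)
    ultimately show "x \<in> (\<lambda>n::int. (of_int n * 2 * pi + c) / k) ` {- \<lceil>M\<rceil>..\<lceil>M\<rceil>}"
      by blast
  qed
  then show ?thesis
    by (rule finite_subset) simp
qed

text \<open>The orbits are pairs {x, f x}; the order singles out the smaller member of each, which
  splits \<open>A\<close> into two halves exchanged by \<open>f\<close>.\<close>

lemma even_card_involution:
  fixes f :: "'a::linorder \<Rightarrow> 'a"
  assumes "finite A"
    and "\<And>x. x \<in> A \<Longrightarrow> f x \<in> A" "\<And>x. x \<in> A \<Longrightarrow> f (f x) = x" "\<And>x. x \<in> A \<Longrightarrow> f x \<noteq> x"
  shows "even (card A)"
proof -
  have "bij_betw f {x\<in>A. x < f x} {x\<in>A. f x < x}"
    by (rule bij_betw_byWitness[where f' = f]) (use assms in auto)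
  then have "card {x\<in>A. x < f x} = card {x\<in>A. f x < x}"
    by (rule bij_betw_same_card)
  moreover have "A = {x\<in>A. x < f x} \<union> {x\<in>A. f x < x}"
    using assms(4) by (auto simp: neq_iff)
  then have "card A = card ({x\<in>A. x < f x} \<union> {x\<in>A. f x < x})"
    by (rule arg_cong)
  then have "card A = card {x\<in>A. x < f x} + card {x\<in>A. f x < x}"
    using assms(1) by (subst (asm) card_Un_disjoint) auto
  ultimately show ?thesis by simp
qed

lemma exists_distinct_of_card_gt_2:
  assumes "card A > 2" "a \<in> A"
  shows "\<exists>x\<in>A. x \<noteq> a \<and> x \<noteq> b"
proof (rule ccontr)
  assume "\<not> ?thesis"
  then have "A \<subseteq> {a, b}" by auto
  then have "card A \<le> card {a, b}" by (intro card_mono) auto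
  also have "\<dots> \<le> 2" by (simp add: card_insert_if)
  finally show False using assms(1) by simp
qed

section \<open>Coincidences of parameters\<close>

lemma sign_vector_nonzero: "sign_vector u \<Longrightarrow> u $ i \<noteq> 0"
  unfolding sign_vector_def by (metis insert_iff singletonD neg_equal_0_iff_equal zero_neq_one)

lemma sign_vector_mult:
  assumes "sign_vector u" "\<And>i. c i = -1 \<or> c i = 1"
  shows "sign_vector (\<chi> i. u $ i * c i)"
  unfolding sign_vector_def
proof
  fix i
  have "u $ i = -1 \<or> u $ i = 1"
    using assms(1) by (auto simp: sign_vector_def)
  then show "(\<chi> i. u $ i * c i) $ i \<in> {- 1, 1}"
    using assms(2)[of i] by auto
qed

lemma lissajous_eq_iff:
  assumes "sign_vector u"
  shows "lissajous q \<alpha> u s = lissajous q \<alpha> u t \<longleftrightarrow>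
    (\<forall>i. cos (real (q $ i) * s - \<alpha> $ i) = cos (real (q $ i) * t - \<alpha> $ i))"
  using sign_vector_nonzero[OF assms] by (simp add: lissajous_def vec_eq_iff)

text \<open>A curve without phases starts at a corner of the cube, where all sines vanish.
  Conversely, at a common zero \<open>s\<close> the addition formula loses its sine terms, and the
  cosines there, being 1 or -1, are absorbed into the signs \<open>u'\<close>.\<close>

lemma degenerate_iff:
  assumes "sign_vector u"
  shows "degenerate q \<alpha> u \<longleftrightarrow> (\<exists>s. \<forall>i. sin (real (q $ i) * s - \<alpha> $ i) = 0)"
proof
  assume "degenerate q \<alpha> u"
  then obtain t' u' where u': "sign_vector u'"
    and eq: "\<And>t. lissajous q \<alpha> u (t - t') = lissajous q 0 u' t"
    unfolding degenerate_def by blast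
  have "sin (real (q $ i) * (- t') - \<alpha> $ i) = 0" for i
  proof -
    have "u $ i * cos (real (q $ i) * (- t') - \<alpha> $ i) = u' $ i"
      using arg_cong[OF eq[of 0], of "\<lambda>v. v $ i"] by (simp add: lissajous_def)
    moreover have "\<bar>u $ i\<bar> = 1" "\<bar>u' $ i\<bar> = 1"
      using assms u' unfolding sign_vector_def by (metis insert_iff singletonD abs_minus abs_1)+
    ultimately have "\<bar>cos (real (q $ i) * (- t') - \<alpha> $ i)\<bar> = 1"
      by (metis abs_mult mult_1)
    then have "(sin (real (q $ i) * (- t') - \<alpha> $ i))\<^sup>2 = 0"
      by (simp add: sin_squared_eq abs_square_eq_1)
    then show ?thesis by simp
  qed
  then show "\<exists>s. \<forall>i. sin (real (q $ i) * s - \<alpha> $ i) = 0" by blast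
next
  assume "\<exists>s. \<forall>i. sin (real (q $ i) * s - \<alpha> $ i) = 0"
  then obtain s where s: "\<And>i. sin (real (q $ i) * s - \<alpha> $ i) = 0" by blast
  define u' where "u' = (\<chi> i. u $ i * cos (real (q $ i) * s - \<alpha> $ i))"
  have "sign_vector u'"
    unfolding u'_def
  proof (rule sign_vector_mult[OF assms])
    fix i
    show "cos (real (q $ i) * s - \<alpha> $ i) = -1 \<or> cos (real (q $ i) * s - \<alpha> $ i) = 1"
      using sin_zero_abs_cos_one[OF s[of i]] by linarith
  qed
  moreover have "lissajous q \<alpha> u (t - (- s)) = lissajous q 0 u' t" for t
  proof -
    have "cos (real (q $ i) * (t + s) - \<alpha> $ i)
        = cos (real (q $ i) * s - \<alpha> $ i) * cos (real (q $ i) * t)" for i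
      using cos_add[of "real (q $ i) * t" "real (q $ i) * s - \<alpha> $ i"] s[of i]
      by (simp add: algebra_simps)
    then show ?thesis
      by (simp add: lissajous_def vec_eq_iff u'_def)
  qed
  ultimately show "degenerate q \<alpha> u"
    unfolding degenerate_def by blast
qed

text \<open>The midpoint (s + t) / 2 is a common zero of the sines, since cos (2 y) = 1 means sin y
  = 0.\<close>

lemma degenerate_if_symmetric:
  assumes "sign_vector u" "\<And>i. cos (real (q $ i) * (s + t) - 2 * \<alpha> $ i) = 1"
  shows "degenerate q \<alpha> u"
proof -
  have "sin (real (q $ i) * ((s + t) / 2) - \<alpha> $ i) = 0" for i
    using assms(2)[of i] by (simp add: cos_double_eq_1_iff[symmetric] right_diff_distrib)
  then show ?thesis
    using degenerate_iff[OF assms(1)] by blast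
qed

text \<open>A superset of the coincidences in which both alternatives occur: equality of the two
  curve points is not demanded. Only finiteness matters.\<close>

definition mixed_pairs :: "nat ^ 'd::finite \<Rightarrow> real ^ 'd \<Rightarrow> (real \<times> real) set" where
  "mixed_pairs q \<alpha> = {(s, t). s \<in> {0..<2 * pi} \<and> t \<in> {0..<2 * pi} \<and>
     (\<exists>i. cos (real (q $ i) * (s - t)) = 1) \<and>
     (\<exists>i. cos (real (q $ i) * (s + t) - 2 * \<alpha> $ i) = 1)}"

text \<open>Difference and sum each range over a finite set, and together they determine the
  pair.\<close>

lemma finite_mixed_pairs:
  assumes "\<forall>i. q $ i \<ge> 1"
  shows "finite (mixed_pairs q \<alpha>)"
proof -
  have nz: "real (q $ i) \<noteq> 0" for i
    using assms by (metis not_one_le_zero of_nat_eq_0_iff)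
  define D where "D = (\<Union>i. {x. - (2 * pi) \<le> x \<and> x \<le> 2 * pi \<and> cos (real (q $ i) * x - 0) = 1})"
  define S where "S = (\<Union>i. {x. 0 \<le> x \<and> x \<le> 4 * pi \<and> cos (real (q $ i) * x - 2 * \<alpha> $ i) = 1})"
  have "finite (D \<times> S)"
    unfolding D_def S_def by (intro finite_cartesian_product finite_UN_I finite_cos_eq_1 nz) auto
  then have "finite ((\<lambda>(x, y). ((x + y) / 2, (y - x) / 2)) ` (D \<times> S))"
    by (rule finite_imageI)
  moreover have "mixed_pairs q \<alpha> \<subseteq> (\<lambda>(x, y). ((x + y) / 2, (y - x) / 2)) ` (D \<times> S)"
  proof
    fix p assume p: "p \<in> mixed_pairs q \<alpha>"
    obtain s t where st: "p = (s, t)" by (cases p)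
    have "s - t \<in> D" "s + t \<in> S"
      using p by (auto simp: mixed_pairs_def D_def S_def st)
    then show "p \<in> (\<lambda>(x, y). ((x + y) / 2, (y - x) / 2)) ` (D \<times> S)"
      by (intro image_eqI[of _ _ "(s - t, s + t)"]) (auto simp: st)
  qed
  ultimately show ?thesis by (rule rev_finite_subset)
qed

text \<open>Each coordinate satisfies one of the two congruences. If neither holds throughout, each
  fails at some coordinate, and there the other one holds.\<close>

lemma lissajous_coincidence_cases:
  assumes "sign_vector u" "lissajous q \<alpha> u s = lissajous q \<alpha> u t"
    and "s \<in> {0..<2 * pi}" "t \<in> {0..<2 * pi}"
  shows "(\<forall>i. cos (real (q $ i) * (s - t)) = 1) \<or>
    (\<forall>i. cos (real (q $ i) * (s + t) - 2 * \<alpha> $ i) = 1) \<or> (s, t) \<in> mixed_pairs q \<alpha>"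
proof -
  have "cos (real (q $ i) * (s - t)) = 1 \<or> cos (real (q $ i) * (s + t) - 2 * \<alpha> $ i) = 1" for i
  proof -
    let ?a = "real (q $ i) * s - \<alpha> $ i" and ?b = "real (q $ i) * t - \<alpha> $ i"
    have c: "cos ?a = cos ?b"
      using assms(1,2) by (simp add: lissajous_eq_iff)
    have "?a - ?b = real (q $ i) * (s - t)" "?a + ?b = real (q $ i) * (s + t) - 2 * \<alpha> $ i"
      by (auto simp: algebra_simps)
    then show ?thesis
      using sin_eq_or_eq_minus[OF c] cos_eq_1_diff[OF c] cos_eq_1_add[OF c] by metis
  qed
  then show ?thesis
    using assms(3,4) by (auto simp: mixed_pairs_def)
qed

section \<open>Sign patterns and the bounds on the number of parameters\<close>

lemma mem_param_set_iff:
  "t \<in> param_set q \<alpha> u x \<longleftrightarrow> t \<in> {0..<2 * pi} \<and> lissajous q \<alpha> u t = x"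
  by (simp add: param_set_def)

lemma frequencies_determine:
  assumes "Gcd (range (\<lambda>i. q $ i)) = 1"
    and "\<And>i. cos (real (q $ i) * (s - t)) = 1"
    and "s \<in> {0..<2 * pi}" "t \<in> {0..<2 * pi}"
  shows "s = t"
proof -
  have "cos (s - t) = 1"
    by (rule cos_eq_1_Gcd[OF _ assms(1)]) (use assms(2) in auto)
  then have "s - t = 0"
    using assms(3,4) by (intro cos_eq_1_small) auto
  then show ?thesis by simp
qed

text \<open>Counting a zero sine as nonnegative is harmless: among parameters of one point, the
  sines of a given coordinate vanish together.\<close>

definition sign_pattern :: "nat ^ 'd::finite \<Rightarrow> real ^ 'd \<Rightarrow> real \<Rightarrow> 'd set" where
  "sign_pattern q \<alpha> t = {i. sin (real (q $ i) * t - \<alpha> $ i) \<ge> 0}"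

text \<open>A point fixes the cosines, hence each sine up to sign; the pattern supplies the sign,
  and the angles then agree modulo 2 pi.\<close>

lemma sign_pattern_inj:
  assumes "Gcd (range (\<lambda>i. q $ i)) = 1" "sign_vector u"
  shows "inj_on (sign_pattern q \<alpha>) (param_set q \<alpha> u x)"
proof (rule inj_onI)
  fix s t
  assume s: "s \<in> param_set q \<alpha> u x" and t: "t \<in> param_set q \<alpha> u x"
    and eq: "sign_pattern q \<alpha> s = sign_pattern q \<alpha> t"
  have "cos (real (q $ i) * (s - t)) = 1" for i
  proof -
    let ?a = "real (q $ i) * s - \<alpha> $ i" and ?b = "real (q $ i) * t - \<alpha> $ i"
    have c: "cos ?a = cos ?b"
      using s t lissajous_eq_iff[OF assms(2), of q \<alpha> s t] by (simp add: mem_param_set_iff)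
    have "sin ?a \<ge> 0 \<longleftrightarrow> sin ?b \<ge> 0"
      using eq by (auto simp: sign_pattern_def set_eq_iff)
    then have "sin ?a = sin ?b"
      using sin_eq_or_eq_minus[OF c] by linarith
    from cos_eq_1_diff[OF c this] show ?thesis
      by (simp add: algebra_simps)
  qed
  then show "s = t"
    using frequencies_determine[OF assms(1)] s t by (auto simp: mem_param_set_iff)
qed

text \<open>In every coordinate exactly one of the two sines is negative, so they are not equal and
  must be negatives of each other.\<close>

lemma sign_pattern_opposite_imp_degenerate:
  assumes "sign_vector u" "s \<in> param_set q \<alpha> u x" "t \<in> param_set q \<alpha> u x"
    and "sign_pattern q \<alpha> s = - sign_pattern q \<alpha> t"
  shows "degenerate q \<alpha> u"
proof (rule degenerate_if_symmetric[OF assms(1)])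
  show "cos (real (q $ i) * (s + t) - 2 * \<alpha> $ i) = 1" for i
  proof -
    let ?a = "real (q $ i) * s - \<alpha> $ i" and ?b = "real (q $ i) * t - \<alpha> $ i"
    have c: "cos ?a = cos ?b"
      using assms(2,3) lissajous_eq_iff[OF assms(1), of q \<alpha> s t]
      by (simp add: mem_param_set_iff)
    have "sin ?a \<ge> 0 \<longleftrightarrow> \<not> sin ?b \<ge> 0"
      using assms(4) by (auto simp: sign_pattern_def set_eq_iff)
    then have "sin ?a = - sin ?b"
      using sin_eq_or_eq_minus[OF c] by linarith
    from cos_eq_1_add[OF c this] show ?thesis
      by (simp add: algebra_simps)
  qed
qed

lemma
  fixes q :: "nat ^ 'd::finite"
  assumes "Gcd (range (\<lambda>i. q $ i)) = 1" "sign_vector u"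
  shows finite_param_set: "finite (param_set q \<alpha> u x)"
    and card_param_set_le: "card (param_set q \<alpha> u x) \<le> 2 ^ CARD('d)"
proof -
  note inj = sign_pattern_inj[OF assms, of \<alpha> x]
  show "finite (param_set q \<alpha> u x)"
    using inj by (rule inj_on_finite[where B = UNIV]) auto
  have "card (param_set q \<alpha> u x) \<le> card (UNIV :: 'd set set)"
    using inj by (rule card_inj_on_le) auto
  then show "card (param_set q \<alpha> u x) \<le> 2 ^ CARD('d)"
    by (simp add: card_Pow flip: Pow_UNIV)
qed

text \<open>No two patterns are complementary here, so patterns up to complement still separate the
  parameters, which halves the bound.\<close>

lemma card_param_set_le_nondegenerate:
  fixes q :: "nat ^ 'd::finite"
  assumes "Gcd (range (\<lambda>i. q $ i)) = 1" "sign_vector u" "\<not> degenerate q \<alpha> u"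
  shows "card (param_set q \<alpha> u x) \<le> 2 ^ (CARD('d) - 1)"
proof -
  fix i0 :: 'd
  \<comment> \<open>\<open>g\<close> picks from each complementary pair the member that omits the
    arbitrary index \<open>i0\<close>.\<close>
  define g :: "'d set \<Rightarrow> 'd set" where "g A = (if i0 \<in> A then - A else A)" for A
  have g: "g A = g B \<Longrightarrow> A = B \<or> A = - B" for A B
    by (auto simp: g_def split: if_splits)
  have "inj_on (g \<circ> sign_pattern q \<alpha>) (param_set q \<alpha> u x)"
  proof (rule inj_onI)
    fix s t
    assume st: "s \<in> param_set q \<alpha> u x" "t \<in> param_set q \<alpha> u x"
      and "(g \<circ> sign_pattern q \<alpha>) s = (g \<circ> sign_pattern q \<alpha>) t"
    then have "g (sign_pattern q \<alpha> s) = g (sign_pattern q \<alpha> t)"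
      by simp
    then have "sign_pattern q \<alpha> s = sign_pattern q \<alpha> t"
      using g sign_pattern_opposite_imp_degenerate[OF assms(2) st] assms(3) by blast
    then show "s = t"
      using sign_pattern_inj[OF assms(1,2)] st by (auto dest: inj_onD)
  qed
  moreover have "(g \<circ> sign_pattern q \<alpha>) ` param_set q \<alpha> u x \<subseteq> Pow (- {i0})"
    by (auto simp: g_def)
  ultimately have "card (param_set q \<alpha> u x) \<le> card (Pow (- {i0}))"
    by (rule card_inj_on_le) simp
  also have "\<dots> = 2 ^ (CARD('d) - 1)"
    by (simp add: card_Pow Compl_eq_Diff_UNIV)
  finally show ?thesis .
qed

section \<open>Finiteness of the set of multiple points\<close>

lemma finite_if_mixed:
  assumes "\<forall>i. q $ i \<ge> 1"
    and "\<And>x. x \<in> X \<Longrightarrow> \<exists>s t. (s, t) \<in> mixed_pairs q \<alpha> \<and> lissajous q \<alpha> u s = x"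
  shows "finite X"
proof (rule finite_subset)
  show "X \<subseteq> (\<lambda>p. lissajous q \<alpha> u (fst p)) ` mixed_pairs q \<alpha>"
    using assms(2) by force
  show "finite ((\<lambda>p. lissajous q \<alpha> u (fst p)) ` mixed_pairs q \<alpha>)"
    using finite_mixed_pairs[OF assms(1)] by simp
qed

text \<open>For distinct parameters of one point the pure difference case contradicts the gcd
  condition and the pure sum case contradicts non-degeneracy; only mixed pairs remain.\<close>

lemma finite_multiple_points_nondegenerate:
  assumes q: "\<forall>i. q $ i \<ge> 1" "Gcd (range (\<lambda>i. q $ i)) = 1"
    and u: "sign_vector u" and nd: "\<not> degenerate q \<alpha> u"
  shows "finite {x. card (param_set q \<alpha> u x) > 1}"
proof (rule finite_if_mixed[OF q(1)])
  fix x assume "x \<in> {x. card (param_set q \<alpha> u x) > 1}"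
  then obtain s t where st: "s \<in> param_set q \<alpha> u x" "t \<in> param_set q \<alpha> u x" "s \<noteq> t"
    using card_le_Suc0_iff_eq[OF finite_param_set[OF q(2) u, of \<alpha> x]]
    by (metis One_nat_def leD mem_Collect_eq)
  have "\<not> (\<forall>i. cos (real (q $ i) * (s - t)) = 1)"
    using frequencies_determine[OF q(2)] st by (auto simp: mem_param_set_iff)
  moreover have "\<not> (\<forall>i. cos (real (q $ i) * (s + t) - 2 * \<alpha> $ i) = 1)"
    using nd degenerate_if_symmetric[OF u] by blast
  ultimately have "(s, t) \<in> mixed_pairs q \<alpha>"
    using lissajous_coincidence_cases[OF u, of q \<alpha> s t] st by (auto simp: mem_param_set_iff)
  then show "\<exists>s t. (s, t) \<in> mixed_pairs q \<alpha> \<and> lissajous q \<alpha> u s = x"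
    using st by (auto simp: mem_param_set_iff)
qed

section \<open>The degenerate case\<close>

text \<open>The reflection about \<open>s\<close>, brought back to [0, 2 pi). For \<open>s\<close>
  in [0, pi) and \<open>t\<close> in [0, 2 pi) the value 2 s - t exceeds -2 pi, so one added period
  suffices.\<close>

definition reflect :: "real \<Rightarrow> real \<Rightarrow> real" where
  "reflect s t = (if t \<le> 2 * s then 2 * s - t else 2 * s - t + 2 * pi)"

lemma sin_add_nat_pi: "sin (x + real n * pi) = 0 \<longleftrightarrow> sin x = 0"
  by (simp add: sin_add)

lemma sin_diff_int_pi: "sin (x - of_int n * pi) = 0 \<longleftrightarrow> sin x = 0"
proof -
  have s: "sin (of_int n * pi) = 0"
    by (simp add: sin_zero_iff_int2)
  then have "cos (of_int n * pi) \<noteq> 0"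
    by (metis sin_zero_abs_cos_one abs_zero zero_neq_one)
  with s show ?thesis
    by (simp add: sin_diff)
qed

text \<open>Normalising the common zero to [0, pi) puts both centres \<open>c\<close> and
  \<open>c + pi\<close> into the parameter interval.\<close>

locale degenerate_curve =
  fixes q :: "nat ^ 'd::finite" and \<alpha> u :: "real ^ 'd" and c :: real
  assumes q_pos: "\<forall>i. q $ i \<ge> 1"
    and Gcd_q: "Gcd (range (\<lambda>i. q $ i)) = 1"
    and sign_u: "sign_vector u"
    and sin_c: "sin (real (q $ i) * c - \<alpha> $ i) = 0"
    and c_range: "0 \<le> c" "c < pi"
begin

lemma cos_2c: "cos (real (q $ i) * (2 * c) - 2 * \<alpha> $ i) = 1"
  using sin_c[of i] by (simp add: cos_double_eq_1_iff[symmetric] right_diff_distrib mult_ac)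

lemma reflect_range: "t \<in> {0..<2 * pi} \<Longrightarrow> reflect c t \<in> {0..<2 * pi}"
  using c_range by (auto simp: reflect_def)

lemma reflect_reflect: "t \<in> {0..<2 * pi} \<Longrightarrow> reflect c (reflect c t) = t"
  using c_range by (auto simp: reflect_def)

text \<open>Each branch of \<open>reflect\<close> contributes one fixed point.\<close>

lemma reflect_fixed_iff: "reflect c t = t \<longleftrightarrow> t = c \<or> t = c + pi"
  using c_range pi_gt_zero by (auto simp: reflect_def)

lemma reflect_eqI:
  assumes "cos (s + t - 2 * c) = 1" "s \<in> {0..<2 * pi}" "t \<in> {0..<2 * pi}"
  shows "s = reflect c t"
proof -
  have "s + t - 2 * c = 0 \<or> s + t - 2 * c = 2 * pi"
    using assms c_range by (intro cos_eq_1_cases_4pi) auto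
  then show ?thesis
    using assms(2) by (auto simp: reflect_def)
qed

text \<open>Reflecting the parameter sends the angle b to e - b with e in 2 pi Z, up to a shift by 2
  pi times the frequency.\<close>

lemma lissajous_reflect: "lissajous q \<alpha> u (reflect c t) = lissajous q \<alpha> u t"
  unfolding lissajous_eq_iff[OF sign_u]
proof
  fix i
  let ?b = "real (q $ i) * t - \<alpha> $ i" and ?e = "real (q $ i) * (2 * c) - 2 * \<alpha> $ i"
  have *: "cos (?e - ?b) = cos ?b"
    by (rule cos_reflect[OF cos_2c])
  have "real (q $ i) * (2 * c - t) - \<alpha> $ i = ?e - ?b"
    by (simp add: algebra_simps)
  with * have **: "cos (real (q $ i) * (2 * c - t) - \<alpha> $ i) = cos ?b" by simp
  have "cos (real (q $ i) * (2 * c - t + 2 * pi) - \<alpha> $ i)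
      = cos ((real (q $ i) * (2 * c - t) - \<alpha> $ i) + 2 * real (q $ i) * pi)"
    by (simp add: algebra_simps)
  also have "\<dots> = cos (real (q $ i) * (2 * c - t) - \<alpha> $ i)"
    by (simp only: cos_add cos_2npi sin_2npi)
  finally show "cos (real (q $ i) * reflect c t - \<alpha> $ i) = cos ?b"
    using ** by (simp add: reflect_def)
qed

lemma reflect_param_set:
  "t \<in> param_set q \<alpha> u x \<Longrightarrow> reflect c t \<in> param_set q \<alpha> u x"
  using reflect_range lissajous_reflect by (simp add: mem_param_set_iff)

lemma sin_fixed:
  assumes "reflect c t = t"
  shows "sin (real (q $ i) * t - \<alpha> $ i) = 0"
proof -
  have "sin (real (q $ i) * (c + pi) - \<alpha> $ i) = 0"
    using sin_c[of i] sin_add_nat_pi[of "real (q $ i) * c - \<alpha> $ i" "q $ i"]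
    by (simp add: algebra_simps)
  then show ?thesis
    using assms sin_c[of i] by (auto simp: reflect_fixed_iff)
qed

text \<open>All sines vanish at a fixed parameter, so the sign ambiguity disappears and the gcd
  condition leaves a single parameter.\<close>

lemma param_set_fixed:
  assumes "reflect c t = t" "t \<in> {0..<2 * pi}"
  shows "param_set q \<alpha> u (lissajous q \<alpha> u t) = {t}"
proof -
  have "s = t" if s: "s \<in> {0..<2 * pi}" "lissajous q \<alpha> u s = lissajous q \<alpha> u t" for s
  proof (rule frequencies_determine[OF Gcd_q _ s(1) assms(2)])
    fix i
    let ?a = "real (q $ i) * s - \<alpha> $ i" and ?b = "real (q $ i) * t - \<alpha> $ i"
    have c: "cos ?a = cos ?b"
      using s(2) by (simp add: lissajous_eq_iff[OF sign_u])
    have "sin ?a = sin ?b"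
      using sin_eq_or_eq_minus[OF c] sin_fixed[OF assms(1), of i] by simp
    from cos_eq_1_diff[OF c this] show "cos (real (q $ i) * (s - t)) = 1"
      by (simp add: algebra_simps)
  qed
  then show ?thesis
    using assms(2) by (auto simp: mem_param_set_iff)
qed

lemma not_fixed:
  assumes "card (param_set q \<alpha> u x) \<ge> 2" "t \<in> param_set q \<alpha> u x"
  shows "reflect c t \<noteq> t"
  using assms param_set_fixed[of t] by (auto simp: mem_param_set_iff)

text \<open>The reflection permutes the parameters of \<open>x\<close>; a fixed one would be the
  only one.\<close>

lemma even_card_param_set:
  assumes "card (param_set q \<alpha> u x) \<ge> 2"
  shows "even (card (param_set q \<alpha> u x))"
proof (rule even_card_involution[where f = "reflect c"])
  show "finite (param_set q \<alpha> u x)"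
    by (rule finite_param_set[OF Gcd_q sign_u])
qed (use assms reflect_param_set reflect_reflect not_fixed in \<open>auto simp: mem_param_set_iff\<close>)

lemma card_param_set_ge_2:
  assumes "t \<in> {0..<2 * pi}" "reflect c t \<noteq> t"
  shows "card (param_set q \<alpha> u (lissajous q \<alpha> u t)) \<ge> 2"
proof -
  have t: "t \<in> param_set q \<alpha> u (lissajous q \<alpha> u t)"
    using assms(1) by (simp add: mem_param_set_iff)
  have "card {t, reflect c t} \<le> card (param_set q \<alpha> u (lissajous q \<alpha> u t))"
    using t reflect_param_set[OF t] finite_param_set[OF Gcd_q sign_u] by (intro card_mono) auto
  then show ?thesis
    using assms(2) by simp
qed

lemma card_simple_points:
  "card {x \<in> lissajous q \<alpha> u ` {0..<2 * pi}. \<not> card (param_set q \<alpha> u x) \<ge> 2} = 2"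
proof -
  have range: "c \<in> {0..<2 * pi}" "c + pi \<in> {0..<2 * pi}"
    using c_range by auto
  have fixed: "reflect c c = c" "reflect c (c + pi) = c + pi"
    by (simp_all add: reflect_fixed_iff)
  note single = param_set_fixed[OF fixed(1) range(1)] param_set_fixed[OF fixed(2) range(2)]
  have "{x \<in> lissajous q \<alpha> u ` {0..<2 * pi}. \<not> card (param_set q \<alpha> u x) \<ge> 2}
      = {lissajous q \<alpha> u c, lissajous q \<alpha> u (c + pi)}"
  proof (intro equalityI subsetI)
    fix x
    assume "x \<in> {x \<in> lissajous q \<alpha> u ` {0..<2 * pi}. \<not> card (param_set q \<alpha> u x) \<ge> 2}"
    then obtain t where t: "t \<in> {0..<2 * pi}" "x = lissajous q \<alpha> u t"
      "\<not> card (param_set q \<alpha> u x) \<ge> 2"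
      by blast
    then have "t = c \<or> t = c + pi"
      using card_param_set_ge_2 reflect_fixed_iff by blast
    then show "x \<in> {lissajous q \<alpha> u c, lissajous q \<alpha> u (c + pi)}"
      using t(2) by auto
  next
    fix x assume "x \<in> {lissajous q \<alpha> u c, lissajous q \<alpha> u (c + pi)}"
    then show "x \<in> {x \<in> lissajous q \<alpha> u ` {0..<2 * pi}. \<not> card (param_set q \<alpha> u x) \<ge> 2}"
      using range single by auto
  qed
  \<comment> \<open>Equal points would have equal parameter sets, but these are {c} and {c +
    pi}.\<close>
  moreover have "lissajous q \<alpha> u c \<noteq> lissajous q \<alpha> u (c + pi)"
    using single by auto
  ultimately show ?thesis by simp
qed

text \<open>Besides \<open>t\<close> and its mirror image there is a third parameter
  \<open>s\<close>. The pure sum case would make \<open>s\<close> that mirror image, so (s, t) is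
  mixed.\<close>

lemma finite_multiple_points: "finite {x. card (param_set q \<alpha> u x) > 2}"
proof (rule finite_if_mixed[OF q_pos])
  fix x assume x: "x \<in> {x. card (param_set q \<alpha> u x) > 2}"
  then obtain t where t: "t \<in> param_set q \<alpha> u x"
    by fastforce
  then obtain s where s: "s \<in> param_set q \<alpha> u x" "s \<noteq> t" "s \<noteq> reflect c t"
    using exists_distinct_of_card_gt_2[of _ t "reflect c t"] x by auto
  have "\<not> (\<forall>i. cos (real (q $ i) * (s - t)) = 1)"
    using frequencies_determine[OF Gcd_q] s t by (auto simp: mem_param_set_iff)
  moreover have "\<not> (\<forall>i. cos (real (q $ i) * (s + t) - 2 * \<alpha> $ i) = 1)"
  proof
    assume *: "\<forall>i. cos (real (q $ i) * (s + t) - 2 * \<alpha> $ i) = 1"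
    \<comment> \<open>Subtracting the congruence for \<open>c\<close> removes the phases, after
      which the gcd condition removes the frequencies.\<close>
    have "cos (real (q $ i) * (s + t - 2 * c)) = 1" for i
      using cos_eq_1_minus[OF *[rule_format, of i] cos_2c[of i]] by (simp add: algebra_simps)
    then have "cos (s + t - 2 * c) = 1"
      using cos_eq_1_Gcd[OF _ Gcd_q, of "s + t - 2 * c"] by blast
    then show False
      using reflect_eqI s t by (auto simp: mem_param_set_iff)
  qed
  ultimately have "(s, t) \<in> mixed_pairs q \<alpha>"
    using lissajous_coincidence_cases[OF sign_u, of q \<alpha> s t] s t by (auto simp: mem_param_set_iff)
  then show "\<exists>s t. (s, t) \<in> mixed_pairs q \<alpha> \<and> lissajous q \<alpha> u s = x"
    using s by (auto simp: mem_param_set_iff)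
qed

end

lemma degenerate_curveE:
  assumes "\<forall>i. q $ i \<ge> 1" "Gcd (range (\<lambda>i. q $ i)) = 1" "sign_vector u" "degenerate q \<alpha> u"
  obtains c where "degenerate_curve q \<alpha> u c"
proof -
  obtain s where s: "\<And>i. sin (real (q $ i) * s - \<alpha> $ i) = 0"
    using assms(4) degenerate_iff[OF assms(3)] by blast
  define n where "n = \<lfloor>s / pi\<rfloor>"
  define c where "c = s - of_int n * pi"
  have "of_int n \<le> s / pi" "s / pi < of_int n + 1"
    unfolding n_def by linarith+
  then have "of_int n * pi \<le> s" "s < (of_int n + 1) * pi"
    by (simp_all add: pos_le_divide_eq pos_divide_less_eq)
  then have c: "0 \<le> c" "c < pi"
    by (simp_all add: c_def algebra_simps)
  \<comment> \<open>Moving the parameter by n pi changes the angle by an integer multiple of pi,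
    because the frequency is an integer.\<close>
  have "sin (real (q $ i) * c - \<alpha> $ i) = 0" for i
    using s[of i] sin_diff_int_pi[of "real (q $ i) * s - \<alpha> $ i" "int (q $ i) * n"]
    by (simp add: c_def algebra_simps)
  then have "degenerate_curve q \<alpha> u c"
    using assms c by unfold_locales auto
  then show thesis by (rule that)
qed

theorem theorem1p1:
  fixes q :: "nat ^ 'd::finite" and \<alpha> u :: "real ^ 'd"
  assumes "\<forall>i. q $ i \<ge> 1"
    and "Gcd (range (\<lambda>i. q $ i)) = 1"
    and "sign_vector u"
  shows "(\<not> degenerate q \<alpha> u \<longrightarrow>
            finite {x. card (param_set q \<alpha> u x) > 1} \<and>
            (\<forall>x. finite (param_set q \<alpha> u x) \<and>
                 card (param_set q \<alpha> u x) \<le> 2 ^ (CARD('d) - 1)))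
       \<and> (degenerate q \<alpha> u \<longrightarrow>
            card {x \<in> lissajous q \<alpha> u ` {0..<2 * pi}. \<not> card (param_set q \<alpha> u x) \<ge> 2} = 2 \<and>
            finite {x. card (param_set q \<alpha> u x) > 2} \<and>
            (\<forall>x. card (param_set q \<alpha> u x) > 2 \<longrightarrow> even (card (param_set q \<alpha> u x))) \<and>
            (\<forall>x. finite (param_set q \<alpha> u x) \<and>
                 card (param_set q \<alpha> u x) \<le> 2 ^ CARD('d)))"
proof (intro conjI impI)
  assume nd: "\<not> degenerate q \<alpha> u"
  show "finite {x. card (param_set q \<alpha> u x) > 1}"
    by (rule finite_multiple_points_nondegenerate[OF assms nd])
  show "\<forall>x. finite (param_set q \<alpha> u x) \<and> card (param_set q \<alpha> u x) \<le> 2 ^ (CARD('d) - 1)"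
    using finite_param_set[OF assms(2,3)] card_param_set_le_nondegenerate[OF assms(2,3) nd]
    by blast
next
  assume "degenerate q \<alpha> u"
  then obtain c where "degenerate_curve q \<alpha> u c"
    by (rule degenerate_curveE[OF assms])
  then interpret degenerate_curve q \<alpha> u c .
  show "card {x \<in> lissajous q \<alpha> u ` {0..<2 * pi}. \<not> card (param_set q \<alpha> u x) \<ge> 2} = 2"
    by (rule card_simple_points)
  show "finite {x. card (param_set q \<alpha> u x) > 2}"
    by (rule finite_multiple_points)
  show "\<forall>x. card (param_set q \<alpha> u x) > 2 \<longrightarrow> even (card (param_set q \<alpha> u x))"
    using even_card_param_set by simp
  show "\<forall>x. finite (param_set q \<alpha> u x) \<and> card (param_set q \<alpha> u x) \<le> 2 ^ CARD('d)"
    using finite_param_set[OF assms(2,3)] card_param_set_le[OF assms(2,3)] by blast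
qed

end
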